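(* Let $(A,\cdot)$ be an anti-Leibniz algebra and $r\in A\otimes A$. If there is an anti-Leibniz bialgebra $(A,\cdot,\Delta_r)$ induced by $r$ and it is factorizable, then $\mathrm{Im}(r^{\sharp}\oplus\tau(r)^{\sharp})$ is an anti-Leibniz subalgebra of the direct sum anti-Leibniz algebra $A\oplus A$, which is isomorphic to the anti-Leibniz algebra $(A^{*},\cdot_r)$. Moreover, any $a\in A$ has a unique decomposition $a=a_{+}+a_{-}$, where $a_{+}\in\mathrm{Im}(r^{\sharp})$ and $a_{-}\in\mathrm{Im}(\tau(r)^{\sharp})$.
   Context: $\Bbbk$ is a field of characteristic zero; all vector spaces and algebras are finite-dimensional over $\Bbbk$. $\tau(a\otimes b)=b\otimes a$. An anti-Leibniz algebra $(A,\cdot)$ is a vector space with a bilinear product such that $a_1(a_2a_3)+(a_1a_2)a_3+a_2(a_1a_3)=0$. $\mathbf{l}_A(a)(b)=ab$, $\mathbf{r}_A(a)(b)=ba$; $\mathbf{l}_A^{*}(a),\mathbf{r}_A^{*}(a)$ are the transposes on $A^{*}$ (no sign). The direct sum $A\oplus A$ has componentwise product. An anti-Leibniz coalgebra is $(A,\Delta)$ with $\Delta:A\to A\otimes A$ linear and $(\Delta\otimes\mathrm{id})\Delta+(\mathrm{id}\otimes\Delta)\Delta+(\tau\otimes\mathrm{id})(\mathrm{id}\otimes\Delta)\Delta=0$. An anti-Leibniz bialgebra is a triple $(A,\cdot,\Delta)$ with $(A,\cdot)$ an anti-Leibniz algebra and $(A,\Delta)$ an anti-Leibniz coalgebra such that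 for all $a_1,a_2\in A$, $\Delta(a_1a_2)+\big(\mathrm{id}\otimes\mathbf{r}_A(a_2)-\mathbf{r}_A(a_2)\otimes\mathrm{id}+\mathbf{l}_A(a_2)\otimes\mathrm{id}\big)(\mathrm{id}\otimes\mathrm{id}-\tau)\Delta(a_1)+\big(\mathrm{id}\otimes\mathbf{l}_A(a_1)+\mathbf{l}_A(a_1)\otimes\mathrm{id}\big)\Delta(a_2)=0$ and $(\mathbf{r}_A(a_1)\otimes\mathrm{id})\Delta(a_2)-\tau\big((\mathbf{r}_A(a_2)\otimes\mathrm{id})\Delta(a_1)\big)=0$. For $r=\sum_i x_i\otimes y_i\in A\otimes A$: $r^{\sharp}:A^{*}\to A$ is defined by $\langle r^{\sharp}(\xi_1),\xi_2\rangle=\langle\xi_1\otimes\xi_2,r\rangle$, i.e. $r^{\sharp}(\xi)=\sum_i\langle\xi,x_i\rangle y_i$, and $\tau(r)^{\sharp}(\xi)=\sum_i\langle\xi,y_i\rangle x_i$. The map $r^{\sharp}\oplus\tau(r)^{\sharp}:A^{*}\to A\oplus A$ is $\xi\mapsto(r^{\sharp}(\xi),\tau(r)^{\sharp}(\xi))$. $r$ is a solution of the anti-Leibniz Yang–Baxter equation if $\sum_{i,j}\big(x_ix_j\otimes y_i\otimes y_j+x_i\otimes y_ix_j\otimes y_j-x_j\otimes x_iy_j\otimes y_i-x_j\otimes x_i\otimes y_iy_j\big)=0$. An element $s\in A\otimes A$ is invariant if $((\mathbf{r}_A-\mathbf{l}_A)(a)\otimes\mathrm{id}+\mathrm{id}\otimes\mathbf{r}_A(a))(s)=0$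 for all $a\in A$. Put $\Delta_r(a)=((\mathbf{r}_A-\mathbf{l}_A)(a)\otimes\mathrm{id}+\mathrm{id}\otimes\mathbf{r}_A(a))(r)$; when $(A,\cdot,\Delta_r)$ is an anti-Leibniz bialgebra it is said to be induced by $r$. If $r$ is a solution of the anti-Leibniz Yang–Baxter equation and $r-\tau(r)$ is invariant, then $(A,\cdot,\Delta_r)$ is an anti-Leibniz bialgebra, called quasi-triangular. A quasi-triangular anti-Leibniz bialgebra is called factorizable if the linear map $\mathcal{I}=r^{\sharp}-\tau(r)^{\sharp}:A^{*}\to A$ is a linear isomorphism. The product on $A^{*}$ dual to $\Delta_r$ is $\xi_1\cdot_r\xi_2=\mathbf{l}_A^{*}(r^{\sharp}(\xi_1))(\xi_2)+\mathbf{l}_A^{*}(\tau(r)^{\sharp}(\xi_2))(\xi_1)-\mathbf{r}_A^{*}(\tau(r)^{\sharp}(\xi_2))(\xi_1)$.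
   Formalization: Uniqueness of a = a₊ + a₋ is false if the components vary independently (zero product on k², r = e⊗f − f⊗e: both images are A); it is proved for decompositions with (a₊, −a₋) in Im(r♯ ⊕ τ(r)♯), i.e. a₊ = r♯(ξ), a₋ = −τ(r)♯(ξ). *)

theory Defs
  imports "HOL-Analysis.Product_Vector" "HOL-Library.Function_Algebras"
begin

section \<open>Dual space and tensors\<close>

text \<open>
  A vector space over the field \<open>'k\<close> is a type \<open>'a\<close> with an explicit scalar multiplication
  \<open>s\<close>, as in \<^theory>\<open>HOL.Vector_Spaces\<close>. Function types carry the pointwise operations of
  \<^theory>\<open>HOL-Library.Function_Algebras\<close>.
\<close>

definition fun_scale :: "'k::times \<Rightarrow> ('b \<Rightarrow> 'k) \<Rightarrow> 'b \<Rightarrow> 'k" where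
  "fun_scale c f = (\<lambda>x. c * f x)"

definition dual :: "('k::field \<Rightarrow> 'a::ab_group_add \<Rightarrow> 'a) \<Rightarrow> ('a \<Rightarrow> 'k) set" where
  "dual s = {\<xi>. Vector_Spaces.linear s (*) \<xi>}"

text \<open>
  The tensor \<open>x \<otimes> y\<close> is represented by the bilinear form \<open>(\<xi>, \<eta>) \<mapsto> \<langle>\<xi>, x\<rangle> \<langle>\<eta>, y\<rangle>\<close> on the dual space,
  and \<open>A \<otimes> A\<close> is the set of finite sums of such forms, that is, the image of the canonical
  injection of \<open>A \<otimes> A\<close> into the bilinear forms on the dual space; similarly for three factors.
  All forms are set to 0 on arguments that are not linear functionals, so that equality of
  tensors is equality in HOL.
\<close>

type_synonym ('a, 'k) tensor2 = "('a \<Rightarrow> 'k) \<Rightarrow> ('a \<Rightarrow> 'k) \<Rightarrow> 'k"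
type_synonym ('a, 'k) tensor3 = "('a \<Rightarrow> 'k) \<Rightarrow> ('a \<Rightarrow> 'k) \<Rightarrow> ('a \<Rightarrow> 'k) \<Rightarrow> 'k"

definition tens2 :: "('k::field \<Rightarrow> 'a::ab_group_add \<Rightarrow> 'a) \<Rightarrow> 'a \<Rightarrow> 'a \<Rightarrow> ('a, 'k) tensor2" where
  "tens2 s x y = (\<lambda>\<xi> \<eta>. if \<xi> \<in> dual s \<and> \<eta> \<in> dual s then \<xi> x * \<eta> y else 0)"

definition tens3 :: "('k::field \<Rightarrow> 'a::ab_group_add \<Rightarrow> 'a) \<Rightarrow> 'a \<Rightarrow> 'a \<Rightarrow> 'a \<Rightarrow> ('a, 'k) tensor3" where
  "tens3 s x y z = (\<lambda>\<xi> \<eta> \<zeta>. if \<xi> \<in> dual s \<and> \<eta> \<in> dual s \<and> \<zeta> \<in> dual s then \<xi> x * \<eta> y * \<zeta> z else 0)"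

definition tensor_square :: "('k::field \<Rightarrow> 'a::ab_group_add \<Rightarrow> 'a) \<Rightarrow> ('a, 'k) tensor2 set" where
  "tensor_square s = {t. \<exists>(n::nat) x y. t = (\<Sum>i<n. tens2 s (x i) (y i))}"

definition tensor_scale :: "'k::field \<Rightarrow> ('a, 'k) tensor2 \<Rightarrow> ('a, 'k) tensor2" where
  "tensor_scale c t = (\<lambda>\<xi> \<eta>. c * t \<xi> \<eta>)"

text \<open>
  \<open>tmap s f g\<close> is \<open>f \<otimes> g\<close>, \<open>tflip\<close> is \<open>\<tau>\<close>, \<open>tmap_left s D\<close> is \<open>D \<otimes> id\<close>, \<open>tmap_right s D\<close> is \<open>id \<otimes> D\<close>
  and \<open>tflip12\<close> is \<open>\<tau> \<otimes> id\<close>; the values on elementary tensors are proved below.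
\<close>

definition tmap :: "('k::field \<Rightarrow> 'a::ab_group_add \<Rightarrow> 'a) \<Rightarrow> ('a \<Rightarrow> 'a) \<Rightarrow> ('a \<Rightarrow> 'a)
    \<Rightarrow> ('a, 'k) tensor2 \<Rightarrow> ('a, 'k) tensor2" where
  "tmap s f g t = (\<lambda>\<xi> \<eta>. if \<xi> \<in> dual s \<and> \<eta> \<in> dual s then t (\<xi> \<circ> f) (\<eta> \<circ> g) else 0)"

definition tflip :: "('a, 'k) tensor2 \<Rightarrow> ('a, 'k) tensor2" where
  "tflip t = (\<lambda>\<xi> \<eta>. t \<eta> \<xi>)"

definition tmap_left :: "('k::field \<Rightarrow> 'a::ab_group_add \<Rightarrow> 'a) \<Rightarrow> ('a \<Rightarrow> ('a, 'k) tensor2)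
    \<Rightarrow> ('a, 'k) tensor2 \<Rightarrow> ('a, 'k) tensor3" where
  "tmap_left s D t = (\<lambda>\<xi> \<eta> \<zeta>. if \<xi> \<in> dual s \<and> \<eta> \<in> dual s \<and> \<zeta> \<in> dual s
     then t (\<lambda>a. D a \<xi> \<eta>) \<zeta> else 0)"

definition tmap_right :: "('k::field \<Rightarrow> 'a::ab_group_add \<Rightarrow> 'a) \<Rightarrow> ('a \<Rightarrow> ('a, 'k) tensor2)
    \<Rightarrow> ('a, 'k) tensor2 \<Rightarrow> ('a, 'k) tensor3" where
  "tmap_right s D t = (\<lambda>\<xi> \<eta> \<zeta>. if \<xi> \<in> dual s \<and> \<eta> \<in> dual s \<and> \<zeta> \<in> dual s
     then t \<xi> (\<lambda>a. D a \<eta> \<zeta>) else 0)"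

definition tflip12 :: "('a, 'k) tensor3 \<Rightarrow> ('a, 'k) tensor3" where
  "tflip12 T = (\<lambda>\<xi> \<eta> \<zeta>. T \<eta> \<xi> \<zeta>)"

section \<open>Anti-Leibniz algebras\<close>

text \<open>
  Algebras live on a subspace \<open>V\<close> of an ambient vector space, so that \<open>A\<close>, \<open>A \<oplus> A\<close>, the dual space
  and subalgebras are treated uniformly.
\<close>

definition anti_leibniz_algebra ::
    "('k::field \<Rightarrow> 'b::ab_group_add \<Rightarrow> 'b) \<Rightarrow> 'b set \<Rightarrow> ('b \<Rightarrow> 'b \<Rightarrow> 'b) \<Rightarrow> bool" where
  "anti_leibniz_algebra s V m \<longleftrightarrow>
     vector_space s \<and> module.subspace s V \<and>
     (\<forall>a\<in>V. \<forall>b\<in>V. m a b \<in> V) \<and>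
     (\<forall>a\<in>V. \<forall>b\<in>V. \<forall>c\<in>V. m (a + b) c = m a c + m b c \<and> m c (a + b) = m c a + m c b) \<and>
     (\<forall>k. \<forall>a\<in>V. \<forall>b\<in>V. m (s k a) b = s k (m a b) \<and> m a (s k b) = s k (m a b)) \<and>
     (\<forall>a\<in>V. \<forall>b\<in>V. \<forall>c\<in>V. m a (m b c) + m (m a b) c + m b (m a c) = 0)"

definition anti_leibniz_subalgebra ::
    "('k::field \<Rightarrow> 'b::ab_group_add \<Rightarrow> 'b) \<Rightarrow> 'b set \<Rightarrow> ('b \<Rightarrow> 'b \<Rightarrow> 'b) \<Rightarrow> 'b set \<Rightarrow> bool" where
  "anti_leibniz_subalgebra s V m W \<longleftrightarrow>
     anti_leibniz_algebra s V m \<and> W \<subseteq> V \<and> module.subspace s W \<and> (\<forall>a\<in>W. \<forall>b\<in>W. m a b \<in> W)"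

definition linear_iso_on ::
    "('k::field \<Rightarrow> 'b::ab_group_add \<Rightarrow> 'b) \<Rightarrow> 'b set \<Rightarrow>
     ('k \<Rightarrow> 'c::ab_group_add \<Rightarrow> 'c) \<Rightarrow> 'c set \<Rightarrow> ('b \<Rightarrow> 'c) \<Rightarrow> bool" where
  "linear_iso_on s V s' W f \<longleftrightarrow>
     (\<forall>u\<in>V. \<forall>v\<in>V. f (u + v) = f u + f v) \<and> (\<forall>c. \<forall>u\<in>V. f (s c u) = s' c (f u)) \<and> bij_betw f V W"

definition algebras_isomorphic ::
    "('k::field \<Rightarrow> 'b::ab_group_add \<Rightarrow> 'b) \<Rightarrow> 'b set \<Rightarrow> ('b \<Rightarrow> 'b \<Rightarrow> 'b) \<Rightarrow>
     ('k \<Rightarrow> 'c::ab_group_add \<Rightarrow> 'c) \<Rightarrow> 'c set \<Rightarrow> ('c \<Rightarrow> 'c \<Rightarrow> 'c) \<Rightarrow> bool" where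
  "algebras_isomorphic s V m s' W m' \<longleftrightarrow>
     (\<exists>f. linear_iso_on s V s' W f \<and> (\<forall>u\<in>V. \<forall>v\<in>V. f (m u v) = m' (f u) (f v)))"

definition direct_sum_mult :: "('a \<Rightarrow> 'a \<Rightarrow> 'a) \<Rightarrow> 'a \<times> 'a \<Rightarrow> 'a \<times> 'a \<Rightarrow> 'a \<times> 'a" where
  "direct_sum_mult m p q = (m (fst p) (fst q), m (snd p) (snd q))"

abbreviation direct_sum_scale ::
    "('k::field \<Rightarrow> 'a::ab_group_add \<Rightarrow> 'a) \<Rightarrow> 'k \<Rightarrow> 'a \<times> 'a \<Rightarrow> 'a \<times> 'a" where
  "direct_sum_scale s \<equiv> module_prod.scale s s"

definition lmul :: "('a \<Rightarrow> 'a \<Rightarrow> 'a) \<Rightarrow> 'a \<Rightarrow> 'a \<Rightarrow> 'a" where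
  "lmul m a = (\<lambda>b. m a b)"

definition rmul :: "('a \<Rightarrow> 'a \<Rightarrow> 'a) \<Rightarrow> 'a \<Rightarrow> 'a \<Rightarrow> 'a" where
  "rmul m a = (\<lambda>b. m b a)"

section \<open>Coalgebras and bialgebras\<close>

definition anti_leibniz_coalgebra ::
    "('k::field \<Rightarrow> 'a::ab_group_add \<Rightarrow> 'a) \<Rightarrow> ('a \<Rightarrow> ('a, 'k) tensor2) \<Rightarrow> bool" where
  "anti_leibniz_coalgebra s D \<longleftrightarrow>
     Vector_Spaces.linear s tensor_scale D \<and> range D \<subseteq> tensor_square s \<and>
     (\<forall>a. tmap_left s D (D a) + tmap_right s D (D a) + tflip12 (tmap_right s D (D a)) = 0)"

definition anti_leibniz_bialgebra ::
    "('k::field \<Rightarrow> 'a::ab_group_add \<Rightarrow> 'a) \<Rightarrow> ('a \<Rightarrow> 'a \<Rightarrow> 'a) \<Rightarrow> ('a \<Rightarrow> ('a, 'k) tensor2) \<Rightarrow> bool"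
  where
  "anti_leibniz_bialgebra s m D \<longleftrightarrow>
     anti_leibniz_algebra s UNIV m \<and> anti_leibniz_coalgebra s D \<and>
     (\<forall>a b. D (m a b)
        + (let u = D a - tflip (D a)
           in tmap s id (rmul m b) u - tmap s (rmul m b) id u + tmap s (lmul m b) id u)
        + (tmap s id (lmul m a) (D b) + tmap s (lmul m a) id (D b)) = 0) \<and>
     (\<forall>a b. tmap s (rmul m a) id (D b) - tflip (tmap s (rmul m b) id (D a)) = 0)"

section \<open>The anti-Leibniz Yang--Baxter equation and factorizability\<close>

text \<open>
  The left-hand side of the equation does not depend on the chosen decomposition
  of \<open>r\<close>; see \<open>anti_leibniz_YBE_sum\<close> below.
\<close>

definition anti_leibniz_YBE ::
    "('k::field \<Rightarrow> 'a::ab_group_add \<Rightarrow> 'a) \<Rightarrow> ('a \<Rightarrow> 'a \<Rightarrow> 'a) \<Rightarrow> ('a, 'k) tensor2 \<Rightarrow> bool" where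
  "anti_leibniz_YBE s m r \<longleftrightarrow>
     (\<exists>(n::nat) x y. r = (\<Sum>i<n. tens2 s (x i) (y i)) \<and>
        (\<Sum>i<n. \<Sum>j<n.
            tens3 s (m (x i) (x j)) (y i) (y j) + tens3 s (x i) (m (y i) (x j)) (y j)
          - tens3 s (x j) (m (x i) (y j)) (y i) - tens3 s (x j) (x i) (m (y i) (y j))) = 0)"

definition coboundary ::
    "('k::field \<Rightarrow> 'a::ab_group_add \<Rightarrow> 'a) \<Rightarrow> ('a \<Rightarrow> 'a \<Rightarrow> 'a) \<Rightarrow> ('a, 'k) tensor2 \<Rightarrow>
     'a \<Rightarrow> ('a, 'k) tensor2" where
  "coboundary s m r a = tmap s (rmul m a - lmul m a) id r + tmap s id (rmul m a) r"

definition invariant ::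
    "('k::field \<Rightarrow> 'a::ab_group_add \<Rightarrow> 'a) \<Rightarrow> ('a \<Rightarrow> 'a \<Rightarrow> 'a) \<Rightarrow> ('a, 'k) tensor2 \<Rightarrow> bool" where
  "invariant s m t \<longleftrightarrow>
     (\<forall>a. tmap s (rmul m a - lmul m a) id t + tmap s id (rmul m a) t = 0)"

text \<open>
  \<open>r\<^sup>\<sharp>(\<xi>)\<close> is determined by \<open>\<langle>r\<^sup>\<sharp>(\<xi>), \<eta>\<rangle> = \<langle>\<xi> \<otimes> \<eta>, r\<rangle>\<close> for all \<open>\<eta>\<close>, because the dual space separates
  points.
\<close>

definition sharp ::
    "('k::field \<Rightarrow> 'a::ab_group_add \<Rightarrow> 'a) \<Rightarrow> ('a, 'k) tensor2 \<Rightarrow> ('a \<Rightarrow> 'k) \<Rightarrow> 'a" where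
  "sharp s r \<xi> = (THE a. \<forall>\<eta>\<in>dual s. \<eta> a = r \<xi> \<eta>)"

definition quasi_triangular ::
    "('k::field \<Rightarrow> 'a::ab_group_add \<Rightarrow> 'a) \<Rightarrow> ('a \<Rightarrow> 'a \<Rightarrow> 'a) \<Rightarrow> ('a, 'k) tensor2 \<Rightarrow> bool" where
  "quasi_triangular s m r \<longleftrightarrow>
     anti_leibniz_bialgebra s m (coboundary s m r) \<and>
     anti_leibniz_YBE s m r \<and> invariant s m (r - tflip r)"

definition factorizable ::
    "('k::field \<Rightarrow> 'a::ab_group_add \<Rightarrow> 'a) \<Rightarrow> ('a \<Rightarrow> 'a \<Rightarrow> 'a) \<Rightarrow> ('a, 'k) tensor2 \<Rightarrow> bool" where
  "factorizable s m r \<longleftrightarrow>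
     quasi_triangular s m r \<and>
     linear_iso_on fun_scale (dual s) s UNIV (\<lambda>\<xi>. sharp s r \<xi> - sharp s (tflip r) \<xi>)"

definition dual_mult ::
    "('k::field \<Rightarrow> 'a::ab_group_add \<Rightarrow> 'a) \<Rightarrow> ('a \<Rightarrow> 'a \<Rightarrow> 'a) \<Rightarrow> ('a, 'k) tensor2 \<Rightarrow>
     ('a \<Rightarrow> 'k) \<Rightarrow> ('a \<Rightarrow> 'k) \<Rightarrow> 'a \<Rightarrow> 'k" where
  "dual_mult s m r \<xi> \<eta> =
     (\<eta> \<circ> lmul m (sharp s r \<xi>)) + (\<xi> \<circ> lmul m (sharp s (tflip r) \<eta>))
       - (\<xi> \<circ> rmul m (sharp s (tflip r) \<eta>))"

text \<open>
  In a decomposition \<open>a = a\<^sub>+ + a\<^sub>-\<close> with \<open>a\<^sub>+ \<in> Im r\<^sup>\<sharp>\<close> and \<open>a\<^sub>- \<in> Im \<tau>(r)\<^sup>\<sharp>\<close>, the two components have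
  to be coupled by \<open>(a\<^sub>+, - a\<^sub>-) \<in> Im (r\<^sup>\<sharp> \<oplus> \<tau>(r)\<^sup>\<sharp>)\<close> for uniqueness to hold. Without the coupling it
  fails: for the zero product on a plane with basis \<open>e, f\<close> and \<open>r = e \<otimes> f - f \<otimes> e\<close>, both images
  are the whole plane. The sign comes from \<open>a = r\<^sup>\<sharp>(\<xi>) - \<tau>(r)\<^sup>\<sharp>(\<xi>)\<close>.
\<close>

definition sharp_pair ::
    "('k::field \<Rightarrow> 'a::ab_group_add \<Rightarrow> 'a) \<Rightarrow> ('a, 'k) tensor2 \<Rightarrow> ('a \<Rightarrow> 'k) \<Rightarrow> 'a \<times> 'a" where
  "sharp_pair s r \<xi> = (sharp s r \<xi>, sharp s (tflip r) \<xi>)"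

section \<open>Agreement with the formulas in terms of elementary tensors\<close>

lemma sum_fun_apply: "(\<Sum>i\<in>I. f i) x = (\<Sum>i\<in>I. f i x)"
  for f :: "'i \<Rightarrow> 'b \<Rightarrow> 'c::comm_monoid_add"
  by (induction I rule: infinite_finite_induct) auto

lemma dual_iff:
  "vector_space s \<Longrightarrow>
    \<xi> \<in> dual s \<longleftrightarrow> (\<forall>a b. \<xi> (a + b) = \<xi> a + \<xi> b) \<and> (\<forall>c a. \<xi> (s c a) = c * \<xi> a)"
  for s :: "'k::field \<Rightarrow> 'a::ab_group_add \<Rightarrow> 'a"
  by (auto simp: dual_def Vector_Spaces.linear_iff vector_space_def algebra_simps)

lemma dual_sum: "\<xi> \<in> dual s \<Longrightarrow> \<xi> (\<Sum>i\<in>I. f i) = (\<Sum>i\<in>I. \<xi> (f i))"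
  unfolding dual_def by (auto intro: module_hom.sum simp: linear_iff_module_hom)

lemma dual_comp: "\<xi> \<in> dual s \<Longrightarrow> Vector_Spaces.linear s s f \<Longrightarrow> \<xi> \<circ> f \<in> dual s"
  unfolding dual_def by (auto intro: Vector_Spaces.linear_compose)

lemma tmap_tens2:
  "Vector_Spaces.linear s s f \<Longrightarrow> Vector_Spaces.linear s s g \<Longrightarrow>
    tmap s f g (tens2 s x y) = tens2 s (f x) (g y)"
  by (intro ext) (auto simp: tmap_def tens2_def dual_comp)

lemma tflip_tens2: "tflip (tens2 s x y) = tens2 s y x"
  by (intro ext) (auto simp: tflip_def tens2_def)

lemma tflip12_tens3: "tflip12 (tens3 s x y z) = tens3 s y x z"
  by (intro ext) (auto simp: tflip12_def tens3_def)

lemma coproduct_functional: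
  assumes "Vector_Spaces.linear s tensor_scale D"
  shows "(\<lambda>a. D a \<xi> \<eta>) \<in> dual s"
proof -
  have "vector_space s" using assms by (simp add: Vector_Spaces.linear_iff)
  with assms show ?thesis by (simp add: dual_iff Vector_Spaces.linear_iff tensor_scale_def)
qed

lemma tmap_left_tens2:
  assumes "Vector_Spaces.linear s tensor_scale D" "D x = (\<Sum>i<n. tens2 s (u i) (v i))"
  shows "tmap_left s D (tens2 s x y) = (\<Sum>i<(n::nat). tens3 s (u i) (v i) y)"
  using coproduct_functional[OF assms(1)]
  by (intro ext)
     (auto simp: tmap_left_def tens2_def tens3_def assms(2) sum_fun_apply sum_distrib_right
           intro!: sum.cong sum.neutral)

lemma tmap_right_tens2:
  assumes "Vector_Spaces.linear s tensor_scale D" "D y = (\<Sum>i<n. tens2 s (u i) (v i))"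
  shows "tmap_right s D (tens2 s x y) = (\<Sum>i<(n::nat). tens3 s x (u i) (v i))"
  using coproduct_functional[OF assms(1)]
  by (intro ext)
     (auto simp: tmap_right_def tens2_def tens3_def assms(2) sum_fun_apply sum_distrib_left mult.assoc
           intro!: sum.cong sum.neutral)

lemma dual_separates:
  fixes s :: "'k::field \<Rightarrow> 'a::ab_group_add \<Rightarrow> 'a"
  assumes "vector_space s" "\<And>\<xi>. \<xi> \<in> dual s \<Longrightarrow> \<xi> a = \<xi> b"
  shows "a = b"
proof (rule ccontr)
  assume "a \<noteq> b"
  interpret vector_space s by fact
  interpret p: vector_space_pair s "(*) :: 'k \<Rightarrow> 'k \<Rightarrow> 'k"
    by unfold_locales (auto simp: algebra_simps)
  have ind: "independent {a - b}" using \<open>a \<noteq> b\<close> by simp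
  from p.linear_independent_extend[OF ind, of "\<lambda>_. 1"]
  obtain g where g: "Vector_Spaces.linear s (*) g" "g (a - b) = 1" by auto
  then have "g (a - b) + g b = g a"
    by (metis diff_add_cancel Vector_Spaces.linear_iff)
  with g assms(2)[of g] show False by (simp add: dual_def)
qed

lemma sharp_sum_tens2:
  assumes "vector_space s" "\<xi> \<in> dual s"
  shows "sharp s (\<Sum>i\<in>I. tens2 s (x i) (y i)) \<xi> = (\<Sum>i\<in>I. s (\<xi> (x i)) (y i))"
proof -
  have *: "\<eta> (\<Sum>i\<in>I. s (\<xi> (x i)) (y i)) = (\<Sum>i\<in>I. tens2 s (x i) (y i)) \<xi> \<eta>"
    if "\<eta> \<in> dual s" for \<eta>
    using that assms dual_iff[OF assms(1), of \<eta>]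
    by (simp add: dual_sum sum_fun_apply tens2_def)
  show ?thesis unfolding sharp_def
  proof (rule the_equality)
    fix a assume "\<forall>\<eta>\<in>dual s. \<eta> a = (\<Sum>i\<in>I. tens2 s (x i) (y i)) \<xi> \<eta>"
    then show "a = (\<Sum>i\<in>I. s (\<xi> (x i)) (y i))"
      using * by (intro dual_separates[OF assms(1)]) simp
  qed (use * in simp)
qed

lemma tflip_sum: "tflip (\<Sum>i\<in>I. t i) = (\<Sum>i\<in>I. tflip (t i))"
  for t :: "'i \<Rightarrow> ('a, 'k::field) tensor2"
  by (intro ext) (simp add: tflip_def sum_fun_apply)

lemma YBE_term_eq:
  assumes "anti_leibniz_algebra s UNIV m" "r = (\<Sum>i\<in>I. tens2 s (x i) (y i))"
    and d: "\<xi> \<in> dual s" "\<eta> \<in> dual s" "\<zeta> \<in> dual s"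
  shows "(\<Sum>i\<in>I. \<Sum>j\<in>I.
            tens3 s (m (x i) (x j)) (y i) (y j) + tens3 s (x i) (m (y i) (x j)) (y j)
          - tens3 s (x j) (m (x i) (y j)) (y i) - tens3 s (x j) (x i) (m (y i) (y j))) \<xi> \<eta> \<zeta>
    = \<xi> (m (sharp s (tflip r) \<eta>) (sharp s (tflip r) \<zeta>))
      + \<eta> (m (sharp s r \<xi>) (sharp s (tflip r) \<zeta>))
      - \<eta> (m (sharp s (tflip r) \<zeta>) (sharp s r \<xi>))
      - \<zeta> (m (sharp s r \<eta>) (sharp s r \<xi>))"
proof -
  have vs: "vector_space s" using assms(1) by (simp add: anti_leibniz_algebra_def)
  interpret vector_space s by fact
  have bil: "m (a + b) c = m a c + m b c" "m c (a + b) = m c a + m c b"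
    "m (s k a) b = s k (m a b)" "m a (s k b) = s k (m a b)" for a b c k
    using assms(1) by (simp_all add: anti_leibniz_algebra_def)
  have z: "m 0 c = 0" "m c 0 = 0" for c
    using bil(3)[of 0 0 c] bil(4)[of c 0 0] by simp_all
  have sl: "m (\<Sum>i\<in>J. f i) c = (\<Sum>i\<in>J. m (f i) c)" for J :: "'c set" and f c
    by (induction J rule: infinite_finite_induct) (simp_all add: z bil)
  have sr: "m c (\<Sum>i\<in>J. f i) = (\<Sum>i\<in>J. m c (f i))" for J :: "'c set" and f c
    by (induction J rule: infinite_finite_induct) (simp_all add: z bil)
  have r: "sharp s r \<theta> = (\<Sum>i\<in>I. s (\<theta> (x i)) (y i))" if "\<theta> \<in> dual s" for \<theta>
    using sharp_sum_tens2[OF vs that] assms(2) by simp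
  have tr: "sharp s (tflip r) \<theta> = (\<Sum>i\<in>I. s (\<theta> (y i)) (x i))" if "\<theta> \<in> dual s" for \<theta>
    using sharp_sum_tens2[OF vs that, of y x] assms(2) by (simp add: tflip_sum tflip_tens2)
  have dsc: "\<theta> (s k a) = k * \<theta> a" if "\<theta> \<in> dual s" for \<theta> k a
    using that dual_iff[OF vs] by blast
  show ?thesis
    by (simp add: r tr d sl sr bil dual_sum[OF d(1)] dual_sum[OF d(2)] dual_sum[OF d(3)]
          dsc sum_fun_apply tens3_def sum.distrib sum_subtractf)
       (intro arg_cong2[where f = "(-)"] arg_cong2[where f = "(+)"];
        subst sum.swap; simp add: sum_distrib_left mult_ac)
qed

lemma anti_leibniz_YBE_sum:
  fixes n :: nat
  assumes "anti_leibniz_algebra s UNIV m"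
  shows "anti_leibniz_YBE s m (\<Sum>i<n. tens2 s (x i) (y i)) \<longleftrightarrow>
     (\<Sum>i<n. \<Sum>j<n.
            tens3 s (m (x i) (x j)) (y i) (y j) + tens3 s (x i) (m (y i) (x j)) (y j)
          - tens3 s (x j) (m (x i) (y j)) (y i) - tens3 s (x j) (x i) (m (y i) (y j))) = 0"
    (is "_ \<longleftrightarrow> ?S n x y = 0")
proof -
  have eq: "?S k u v = ?S n x y"
    if "(\<Sum>i<n. tens2 s (x i) (y i)) = (\<Sum>i<k. tens2 s (u i) (v i))" for k u v
  proof (intro ext)
    fix \<xi> \<eta> \<zeta>
    show "?S k u v \<xi> \<eta> \<zeta> = ?S n x y \<xi> \<eta> \<zeta>"
    proof (cases "\<xi> \<in> dual s \<and> \<eta> \<in> dual s \<and> \<zeta> \<in> dual s")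
      case True
      show ?thesis
        by (rule trans[OF YBE_term_eq[OF assms that] sym[OF YBE_term_eq[OF assms refl]]])
           (use True in simp_all)
    next
      case False
      then show ?thesis by (auto simp: sum_fun_apply tens3_def)
    qed
  qed
  show ?thesis unfolding anti_leibniz_YBE_def
  proof (rule iffI, elim exE conjE)
    fix k u v
    assume "(\<Sum>i<n. tens2 s (x i) (y i)) = (\<Sum>i<k. tens2 s (u i) (v i))" and 0: "?S k u v = 0"
    from eq[OF this(1)] show "?S n x y = 0"
      by (rule subst[where P = "\<lambda>T. T = 0"]) (rule 0)
  qed (rule exI conjI refl | assumption)+
qed

text \<open>\<open>dual_mult\<close> is the transpose of the coboundary coproduct.\<close>

lemma dual_mult_pairing:
  assumes alg: "anti_leibniz_algebra s UNIV m" and r: "r \<in> tensor_square s"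
    and d: "\<xi> \<in> dual s" "\<eta> \<in> dual s"
  shows "dual_mult s m r \<xi> \<eta> a = coboundary s m r a \<xi> \<eta>"
proof -
  have vs: "vector_space s" using alg by (simp add: anti_leibniz_algebra_def)
  interpret vector_space s by fact
  have bil: "m (a + b) c = m a c + m b c" "m c (a + b) = m c a + m c b"
    "m (s k a) b = s k (m a b)" "m a (s k b) = s k (m a b)" for a b c k
    using alg by (simp_all add: anti_leibniz_algebra_def)
  have dl: "\<theta> (u + v) = \<theta> u + \<theta> v" "\<theta> (s k u) = k * \<theta> u" "\<theta> (u - v) = \<theta> u - \<theta> v"
    if "\<theta> \<in> dual s" for \<theta> u v k
  proof -
    show *: "\<theta> (u + v) = \<theta> u + \<theta> v" "\<theta> (s k u) = k * \<theta> u" for u v k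
      using that dual_iff[OF vs] by blast+
    show "\<theta> (u - v) = \<theta> u - \<theta> v"
      using *(1)[of "u - v" v] by simp
  qed
  obtain n :: nat and x y where re: "r = (\<Sum>i<n. tens2 s (x i) (y i))"
    using r by (auto simp: tensor_square_def)
  have sh: "sharp s r \<theta> = (\<Sum>i<n. s (\<theta> (x i)) (y i))"
    "sharp s (tflip r) \<theta> = (\<Sum>i<n. s (\<theta> (y i)) (x i))" if "\<theta> \<in> dual s" for \<theta>
    using sharp_sum_tens2[OF vs that] re by (simp_all add: tflip_sum tflip_tens2)
  have lin: "\<theta> \<circ> lmul m b \<in> dual s" "\<theta> \<circ> rmul m b \<in> dual s"
    "\<theta> \<circ> (rmul m b - lmul m b) \<in> dual s" if "\<theta> \<in> dual s" for \<theta> b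
    using that dl[OF that] by (simp_all add: dual_iff[OF vs] lmul_def rmul_def bil right_diff_distrib)
  have pair: "\<theta> (sharp s r \<xi>) = r \<xi> \<theta>" "\<theta> (sharp s (tflip r) \<eta>) = r \<theta> \<eta>" if "\<theta> \<in> dual s" for \<theta>
    unfolding sh(1)[OF d(1)] sh(2)[OF d(2)] using that d
    by (simp_all add: dual_sum[OF that] dl[OF that] re sum_fun_apply tens2_def mult.commute)
  have "r (\<xi> \<circ> (rmul m a - lmul m a)) \<eta> = r (\<xi> \<circ> rmul m a) \<eta> - r (\<xi> \<circ> lmul m a) \<eta>"
    using d lin[OF d(1)] dl[OF d(1)]
    by (simp add: re sum_fun_apply tens2_def left_diff_distrib sum_subtractf)
  then show ?thesis
    using pair(1)[OF lin(2)[OF d(2), of a]] pair(2)[OF lin(2)[OF d(1), of a]]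
      pair(2)[OF lin(1)[OF d(1), of a]] d
    by (simp add: dual_mult_def coboundary_def tmap_def lmul_def rmul_def o_def)
qed

end

(*
  Write P and Q for the sharp maps of r and of its flip, so that <P xi, eta> = <Q eta, xi>.
  Contracted with three functionals, the Yang--Baxter equation says that Q is multiplicative for the
  product on the dual; together with the invariance of r - tau(r) it says that P is multiplicative
  as well. Since P - Q is bijective, the map (P, Q) is injective, so it carries the dual
  isomorphically onto a subalgebra of the direct sum, which makes the dual anti-Leibniz; moreover
  a = P xi - Q xi for a unique xi.
*)
theory Submission
  imports Defs
begin

section \<open>Linear structure of the dual space and of the direct sum\<close>

lemma dual_linear:
  assumes "vector_space s" "\<xi> \<in> dual s"
  shows "\<xi> (a + b) = \<xi> a + \<xi> b" "\<xi> (s c a) = c * \<xi> a" "\<xi> (a - b) = \<xi> a - \<xi> b"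
proof -
  show *: "\<xi> (a + b) = \<xi> a + \<xi> b" "\<xi> (s c a) = c * \<xi> a" for a b c
    using assms dual_iff[OF assms(1)] by blast+
  show "\<xi> (a - b) = \<xi> a - \<xi> b"
    using *(1)[of "a - b" b] by simp
qed

lemma dual_closed:
  assumes "vector_space s"
  shows "0 \<in> dual s" "\<xi> \<in> dual s \<Longrightarrow> \<eta> \<in> dual s \<Longrightarrow> \<xi> + \<eta> \<in> dual s"
    "\<xi> \<in> dual s \<Longrightarrow> \<eta> \<in> dual s \<Longrightarrow> \<xi> - \<eta> \<in> dual s"
    "\<xi> \<in> dual s \<Longrightarrow> fun_scale c \<xi> \<in> dual s"
  by (simp_all add: dual_iff[OF assms] fun_scale_def algebra_simps)

lemma vector_space_fun_scale: "vector_space (fun_scale :: 'k::field \<Rightarrow> ('b \<Rightarrow> 'k) \<Rightarrow> 'b \<Rightarrow> 'k)"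
  by unfold_locales (simp_all add: fun_scale_def fun_eq_iff algebra_simps)

lemma subspace_dual: "vector_space s \<Longrightarrow> module.subspace fun_scale (dual s)"
  by (simp add: module.subspace_def vector_space_fun_scale module_iff_vector_space dual_closed)

lemma direct_sum_scale_Pair:
  assumes "vector_space s"
  shows "direct_sum_scale s c (a, b) = (s c a, s c b)"
proof -
  interpret vector_space s by fact
  interpret vector_space_prod s s by unfold_locales
  show ?thesis by (simp add: scale_def)
qed

lemma vector_space_direct_sum_scale:
  assumes "vector_space s"
  shows "vector_space (direct_sum_scale s)"
proof -
  interpret vector_space s by fact
  interpret vector_space_prod s s by unfold_locales
  show ?thesis by (rule p.vector_space_axioms)
qed

section \<open>The sharp maps of a tensor and of its flip\<close>

lemma tflip_tensor_square: "r \<in> tensor_square s \<Longrightarrow> tflip r \<in> tensor_square s"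
  unfolding tensor_square_def by (force simp: tflip_sum tflip_tens2)

text \<open>\<open>sharp\<close> is a definite description, so its defining property needs a
  witness: a decomposition of r into elementary tensors supplies one. Later arguments can then work
  with pairings instead of decompositions.\<close>

lemma sharp_pairing:
  assumes "vector_space s" "r \<in> tensor_square s" "\<xi> \<in> dual s" "\<eta> \<in> dual s"
  shows "\<eta> (sharp s r \<xi>) = r \<xi> \<eta>"
proof -
  obtain n :: nat and x y where r: "r = (\<Sum>i<n. tens2 s (x i) (y i))"
    using assms(2) by (auto simp: tensor_square_def)
  show ?thesis
    unfolding r sharp_sum_tens2[OF assms(1,3)] using assms
    by (simp add: dual_sum[OF assms(4)] dual_linear[OF assms(1,4)] sum_fun_apply tens2_def)
qed

text \<open>With \<open>sharp_pairing\<close> this makes P and Q transposes of each other: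
  \<open>r \<eta> \<xi>\<close> can be read as a value at P eta or at Q xi.\<close>

lemma sharp_tflip_pairing:
  assumes "vector_space s" "r \<in> tensor_square s" "\<xi> \<in> dual s" "\<eta> \<in> dual s"
  shows "\<eta> (sharp s (tflip r) \<xi>) = r \<eta> \<xi>"
  using sharp_pairing[OF assms(1) tflip_tensor_square[OF assms(2)] assms(3,4)]
  by (simp add: tflip_def)

lemma sharp_linear:
  assumes "vector_space s" "r \<in> tensor_square s" "\<xi> \<in> dual s"
  shows "\<eta> \<in> dual s \<Longrightarrow> sharp s r (\<xi> + \<eta>) = sharp s r \<xi> + sharp s r \<eta>"
    "sharp s r (fun_scale c \<xi>) = s c (sharp s r \<xi>)"
proof -
  interpret vector_space s by fact
  obtain n :: nat and x y where r: "r = (\<Sum>i<n. tens2 s (x i) (y i))"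
    using assms(2) by (auto simp: tensor_square_def)
  show "sharp s r (\<xi> + \<eta>) = sharp s r \<xi> + sharp s r \<eta>" if "\<eta> \<in> dual s"
    using assms that
    by (simp add: r sharp_sum_tens2 dual_closed scale_left_distrib sum.distrib)
  show "sharp s r (fun_scale c \<xi>) = s c (sharp s r \<xi>)"
    using assms
    \<comment> \<open>\<open>fun_scale\<close> stays folded at first, since
      \<open>sharp_sum_tens2\<close> needs the scaled functional to lie in
      \<open>dual s\<close>.\<close>
    by (simp add: r sharp_sum_tens2 dual_closed scale_sum_right) (simp add: fun_scale_def)
qed

section \<open>Invariance and the Yang--Baxter equation on functionals; multiplicativity of the
  sharp maps\<close>

lemma mul_bilinear:
  assumes "anti_leibniz_algebra s UNIV m"
  shows "m (a + b) c = m a c + m b c" "m c (a + b) = m c a + m c b"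
    "m (s k a) b = s k (m a b)" "m a (s k b) = s k (m a b)"
    "m (a - b) c = m a c - m b c" "m c (a - b) = m c a - m c b"
proof -
  show *: "m (a + b) c = m a c + m b c" "m c (a + b) = m c a + m c b"
    "m (s k a) b = s k (m a b)" "m a (s k b) = s k (m a b)" for a b c k
    using assms by (simp_all add: anti_leibniz_algebra_def)
  show "m (a - b) c = m a c - m b c" "m c (a - b) = m c a - m c b"
    using *(1)[of "a - b" b c] *(2)[of c "a - b" b] by simp_all
qed

text \<open>These are the transposed multiplication operators. Tensors vanish by convention off the
  dual space, so membership must be known before a pairing rule can be applied to them.\<close>

lemma dual_comp_mul:
  assumes "anti_leibniz_algebra s UNIV m" "\<xi> \<in> dual s"
  shows "\<xi> \<circ> lmul m a \<in> dual s" "\<xi> \<circ> rmul m a \<in> dual s"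
    "\<xi> \<circ> (rmul m a - lmul m a) \<in> dual s"
proof -
  have vs: "vector_space s" using assms(1) by (simp add: anti_leibniz_algebra_def)
  show "\<xi> \<circ> lmul m a \<in> dual s" "\<xi> \<circ> rmul m a \<in> dual s" "\<xi> \<circ> (rmul m a - lmul m a) \<in> dual s"
    using mul_bilinear[OF assms(1)] dual_linear[OF vs assms(2)]
    by (simp_all add: dual_iff[OF vs] lmul_def rmul_def right_diff_distrib)
qed

lemma dual_mult_closed:
  assumes "anti_leibniz_algebra s UNIV m" "\<xi> \<in> dual s" "\<eta> \<in> dual s"
  shows "dual_mult s m r \<xi> \<eta> \<in> dual s"
  using assms
  by (auto simp: dual_mult_def anti_leibniz_algebra_def intro!: dual_closed dual_comp_mul[OF assms(1)])

text \<open>Evaluating the invariance of r - tau(r) at (xi, eta) and transposing gathers the values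
  of r into the map I = P - Q. In this form invariance lets P and Q be exchanged inside
  products.\<close>

lemma invariant_pairing:
  assumes "anti_leibniz_algebra s UNIV m" "r \<in> tensor_square s" "invariant s m (r - tflip r)"
    and d: "\<xi> \<in> dual s" "\<eta> \<in> dual s"
  defines "I \<equiv> \<lambda>\<xi>. sharp s r \<xi> - sharp s (tflip r) \<xi>"
  shows "\<xi> (m (I \<eta>) a) = \<xi> (m a (I \<eta>)) + \<eta> (m (I \<xi>) a)"
proof -
  have vs: "vector_space s" using assms(1) by (simp add: anti_leibniz_algebra_def)
  note [simp] = d dual_comp_mul[OF assms(1)] dual_linear[OF vs d(1)] dual_linear[OF vs d(2)]
    mul_bilinear[OF assms(1)]
  let ?f = "\<xi> \<circ> (rmul m a - lmul m a)" and ?g = "\<eta> \<circ> rmul m a"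
  have "(tmap s (rmul m a - lmul m a) id (r - tflip r) + tmap s id (rmul m a) (r - tflip r)) \<xi> \<eta> = 0"
    using assms(3) by (simp add: invariant_def)
  then have "r ?f \<eta> - r \<eta> ?f + (r \<xi> ?g - r ?g \<xi>) = 0"
    by (simp add: tmap_def tflip_def)
  \<comment> \<open>Each value of r is read as \<open>?f\<close> or \<open>?g\<close> applied to a
    sharp of the untouched functional, which leaves - I eta under \<open>?f\<close> and I xi under
    \<open>?g\<close>.\<close>
  then have "?f (sharp s (tflip r) \<eta>) - ?f (sharp s r \<eta>)
      + (?g (sharp s r \<xi>) - ?g (sharp s (tflip r) \<xi>)) = 0"
    by (simp only: sharp_pairing[OF vs assms(2)] sharp_tflip_pairing[OF vs assms(2)] d
        dual_comp_mul[OF assms(1)])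
  then show ?thesis
    by (simp add: I_def lmul_def rmul_def algebra_simps)
qed

text \<open>The decomposition of r hidden in \<open>anti_leibniz_YBE\<close> is used once, here; in
  terms of P and Q the equation no longer mentions it.\<close>

lemma YBE_pairing:
  assumes "anti_leibniz_algebra s UNIV m" "anti_leibniz_YBE s m r"
    and "\<xi> \<in> dual s" "\<eta> \<in> dual s" "\<zeta> \<in> dual s"
  shows "\<xi> (m (sharp s (tflip r) \<eta>) (sharp s (tflip r) \<zeta>))
      + \<eta> (m (sharp s r \<xi>) (sharp s (tflip r) \<zeta>))
      - \<eta> (m (sharp s (tflip r) \<zeta>) (sharp s r \<xi>))
      - \<zeta> (m (sharp s r \<eta>) (sharp s r \<xi>)) = 0"
proof -
  obtain n :: nat and x y where "r = (\<Sum>i<n. tens2 s (x i) (y i))"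
    "(\<Sum>i<n. \<Sum>j<n.
            tens3 s (m (x i) (x j)) (y i) (y j) + tens3 s (x i) (m (y i) (x j)) (y j)
          - tens3 s (x j) (m (x i) (y j)) (y i) - tens3 s (x j) (x i) (m (y i) (y j))) = 0"
    using assms(2) unfolding anti_leibniz_YBE_def by blast
  from YBE_term_eq[OF assms(1) this(1) assms(3-5)] this(2) show ?thesis by simp
qed

text \<open>Paired with zeta, the left side is the dual product evaluated at P zeta. Its three terms
  are exactly those that accompany \<open>\<zeta> (m (Q \<xi>) (Q \<eta>))\<close> in the
  Yang--Baxter equation at (zeta, xi, eta).\<close>

lemma sharp_tflip_dual_mult:
  assumes "anti_leibniz_algebra s UNIV m" "r \<in> tensor_square s" "anti_leibniz_YBE s m r"
    and d: "\<xi> \<in> dual s" "\<eta> \<in> dual s"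
  shows "sharp s (tflip r) (dual_mult s m r \<xi> \<eta>) = m (sharp s (tflip r) \<xi>) (sharp s (tflip r) \<eta>)"
proof -
  have vs: "vector_space s" using assms(1) by (simp add: anti_leibniz_algebra_def)
  show ?thesis
  proof (rule dual_separates[OF vs])
    fix \<zeta> assume z: "\<zeta> \<in> dual s"
    have dm: "dual_mult s m r \<xi> \<eta> \<in> dual s"
      by (rule dual_mult_closed[OF assms(1) d])
    have "\<zeta> (sharp s (tflip r) (dual_mult s m r \<xi> \<eta>))
        = \<eta> (m (sharp s r \<xi>) (sharp s r \<zeta>)) + \<xi> (m (sharp s (tflip r) \<eta>) (sharp s r \<zeta>))
          - \<xi> (m (sharp s r \<zeta>) (sharp s (tflip r) \<eta>))"
      using sharp_tflip_pairing[OF vs assms(2) dm z] sharp_pairing[OF vs assms(2) z dm]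
      by (simp add: dual_mult_def lmul_def rmul_def)
    then show "\<zeta> (sharp s (tflip r) (dual_mult s m r \<xi> \<eta>))
        = \<zeta> (m (sharp s (tflip r) \<xi>) (sharp s (tflip r) \<eta>))"
      using YBE_pairing[OF assms(1,3) z d] by algebra
  qed
qed

text \<open>Here the dual product is evaluated at Q zeta. The Yang--Baxter equation gives nearly the
  same three terms, but with the roles of P and Q on xi and eta exchanged; invariance accounts for
  the discrepancy.\<close>

lemma sharp_dual_mult:
  assumes "anti_leibniz_algebra s UNIV m" "r \<in> tensor_square s" "anti_leibniz_YBE s m r"
    and "invariant s m (r - tflip r)"
    and d: "\<xi> \<in> dual s" "\<eta> \<in> dual s"
  shows "sharp s r (dual_mult s m r \<xi> \<eta>) = m (sharp s r \<xi>) (sharp s r \<eta>)"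
proof -
  have vs: "vector_space s" using assms(1) by (simp add: anti_leibniz_algebra_def)
  show ?thesis
  proof (rule dual_separates[OF vs])
    fix \<zeta> assume z: "\<zeta> \<in> dual s"
    have dm: "dual_mult s m r \<xi> \<eta> \<in> dual s"
      by (rule dual_mult_closed[OF assms(1) d])
    have "\<zeta> (sharp s r (dual_mult s m r \<xi> \<eta>))
        = \<eta> (m (sharp s r \<xi>) (sharp s (tflip r) \<zeta>))
          + \<xi> (m (sharp s (tflip r) \<eta>) (sharp s (tflip r) \<zeta>))
          - \<xi> (m (sharp s (tflip r) \<zeta>) (sharp s (tflip r) \<eta>))"
      using sharp_pairing[OF vs assms(2) dm z] sharp_tflip_pairing[OF vs assms(2) z dm]
      by (simp add: dual_mult_def lmul_def rmul_def)
    then show "\<zeta> (sharp s r (dual_mult s m r \<xi> \<eta>)) = \<zeta> (m (sharp s r \<xi>) (sharp s r \<eta>))"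
      \<comment> \<open>The order (eta, xi, zeta) makes the last Yang--Baxter term the pairing of
        zeta with P xi times P eta. The two expressions then differ by the invariance relation at a
        = Q zeta.\<close>
      using YBE_pairing[OF assms(1,3) d(2,1) z]
        invariant_pairing[OF assms(1,2,4) d, of "sharp s (tflip r) \<zeta>"]
      unfolding mul_bilinear[OF assms(1)] dual_linear[OF vs d(1)] dual_linear[OF vs d(2)]
      by algebra
  qed
qed

section \<open>Direct sums and transport of the anti-Leibniz axioms\<close>

lemma anti_leibniz_algebra_direct_sum:
  assumes "anti_leibniz_algebra s UNIV m"
  shows "anti_leibniz_algebra (direct_sum_scale s) UNIV (direct_sum_mult m)"
proof -
  have vs: "vector_space s" using assms by (simp add: anti_leibniz_algebra_def)
  have "module.subspace (direct_sum_scale s) UNIV"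
    using vector_space_direct_sum_scale[OF vs]
    by (simp add: module.subspace_def module_iff_vector_space)
  then show ?thesis
    using assms vector_space_direct_sum_scale[OF vs]
    by (simp add: anti_leibniz_algebra_def direct_sum_mult_def direct_sum_scale_Pair[OF vs]
        zero_prod_def)
qed

text \<open>An identity in V holds once it holds after applying the injective f, where it becomes an
  axiom of W. Closure of V under the product is what keeps both sides within the domain of
  injectivity.\<close>

lemma anti_leibniz_algebra_pullback:
  assumes B: "anti_leibniz_algebra s' W m'"
    and V: "vector_space s" "module.subspace s V" "\<And>a b. a \<in> V \<Longrightarrow> b \<in> V \<Longrightarrow> m a b \<in> V"
    and f: "inj_on f V" "\<And>a. a \<in> V \<Longrightarrow> f a \<in> W"
      "\<And>a b. a \<in> V \<Longrightarrow> b \<in> V \<Longrightarrow> f (a + b) = f a + f b"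
      "\<And>c a. a \<in> V \<Longrightarrow> f (s c a) = s' c (f a)"
      "\<And>a b. a \<in> V \<Longrightarrow> b \<in> V \<Longrightarrow> f (m a b) = m' (f a) (f b)"
  shows "anti_leibniz_algebra s V m"
proof -
  interpret vector_space s by fact
  have cl: "0 \<in> V" "\<And>a b. a \<in> V \<Longrightarrow> b \<in> V \<Longrightarrow> a + b \<in> V" "\<And>c a. a \<in> V \<Longrightarrow> s c a \<in> V"
    using V(2) by (auto simp: subspace_def)
  have f0: "f 0 = 0" using f(3)[OF cl(1) cl(1)] by simp
  note eqI = inj_onD[OF f(1)]
  show ?thesis
    unfolding anti_leibniz_algebra_def
    using B V(1,2)
    by (intro conjI ballI allI; (intro eqI)?)
      (auto simp: cl V(3) f f0 anti_leibniz_algebra_def)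
qed

theorem proposition3p25:
  fixes s :: "'k::field_char_0 \<Rightarrow> 'a::ab_group_add \<Rightarrow> 'a"
    and Basis :: "'a set"
    and m :: "'a \<Rightarrow> 'a \<Rightarrow> 'a"
    and r :: "('a, 'k) tensor2"
  assumes "finite_dimensional_vector_space s Basis"
    and "anti_leibniz_algebra s UNIV m"
    and "r \<in> tensor_square s"
    and "anti_leibniz_bialgebra s m (coboundary s m r)"
    and "factorizable s m r"
  shows "anti_leibniz_subalgebra (direct_sum_scale s) UNIV (direct_sum_mult m)
           (sharp_pair s r ` dual s)
       \<and> anti_leibniz_algebra fun_scale (dual s) (dual_mult s m r)
       \<and> algebras_isomorphic (direct_sum_scale s) (sharp_pair s r ` dual s) (direct_sum_mult m)
           fun_scale (dual s) (dual_mult s m r)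
       \<and> (\<forall>a. \<exists>!d. case d of (a_plus, a_minus) \<Rightarrow>
            a = a_plus + a_minus
            \<and> a_plus \<in> sharp s r ` dual s \<and> a_minus \<in> sharp s (tflip r) ` dual s
            \<and> (a_plus, - a_minus) \<in> sharp_pair s r ` dual s)"
proof -
  let ?P = "sharp s r" and ?Q = "sharp s (tflip r)" and ?F = "sharp_pair s r"
  let ?W = "?F ` dual s" and ?M = "dual_mult s m r"
  have vs: "vector_space s" using assms(2) by (simp add: anti_leibniz_algebra_def)
  interpret vector_space s by fact
  have YBE: "anti_leibniz_YBE s m r" and inv: "invariant s m (r - tflip r)"
    and bij: "bij_betw (\<lambda>\<xi>. ?P \<xi> - ?Q \<xi>) (dual s) UNIV"
    using assms(5) by (simp_all add: factorizable_def quasi_triangular_def linear_iso_on_def)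
  note sq = assms(3) tflip_tensor_square[OF assms(3)]
  have F_add: "?F (\<xi> + \<eta>) = ?F \<xi> + ?F \<eta>" if "\<xi> \<in> dual s" "\<eta> \<in> dual s" for \<xi> \<eta>
    using that sq by (simp add: sharp_pair_def sharp_linear[OF vs])
  have F_scale: "?F (fun_scale c \<xi>) = direct_sum_scale s c (?F \<xi>)" if "\<xi> \<in> dual s" for c \<xi>
    using that sq by (simp add: sharp_pair_def sharp_linear[OF vs] direct_sum_scale_Pair[OF vs])
  have F_mult: "?F (?M \<xi> \<eta>) = direct_sum_mult m (?F \<xi>) (?F \<eta>)"
    if "\<xi> \<in> dual s" "\<eta> \<in> dual s" for \<xi> \<eta>
    using sharp_dual_mult[OF assms(2,3) YBE inv that] sharp_tflip_dual_mult[OF assms(2,3) YBE that]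
    by (simp add: sharp_pair_def direct_sum_mult_def)
  have F_zero: "?F 0 = 0" using F_add[of 0 0] dual_closed(1)[OF vs] by simp
  \<comment> \<open>Equal pairs have equal differences of components, and P - Q is
    injective.\<close>
  have inj: "inj_on ?F (dual s)"
    using bij by (auto simp: bij_betw_def inj_on_def sharp_pair_def)
  have ds: "anti_leibniz_algebra (direct_sum_scale s) UNIV (direct_sum_mult m)"
    by (rule anti_leibniz_algebra_direct_sum[OF assms(2)])
  have "module (direct_sum_scale s)"
    using vector_space_direct_sum_scale[OF vs] by (simp add: module_iff_vector_space)
  then have "module.subspace (direct_sum_scale s) ?W"
    unfolding module.subspace_def[OF \<open>module (direct_sum_scale s)\<close>]
    using dual_closed[OF vs] F_zero
    by (auto simp flip: F_add F_scale intro: rev_image_eqI)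
  then have sub: "anti_leibniz_subalgebra (direct_sum_scale s) UNIV (direct_sum_mult m) ?W"
    using ds dual_mult_closed[OF assms(2)]
    by (auto simp: anti_leibniz_subalgebra_def simp flip: F_mult)
  \<comment> \<open>The identities on the dual are pulled back along (P, Q) from the direct
    sum.\<close>
  have dual: "anti_leibniz_algebra fun_scale (dual s) ?M"
    by (rule anti_leibniz_algebra_pullback[where f = ?F, OF ds vector_space_fun_scale subspace_dual[OF vs]])
      (simp_all add: dual_mult_closed[OF assms(2)] inj F_add F_scale F_mult)
  \<comment> \<open>The isomorphism is required from the image to the dual, hence the inverse of (P,
    Q).\<close>
  let ?G = "the_inv_into (dual s) ?F"
  have G: "?G (?F \<xi>) = \<xi>" if "\<xi> \<in> dual s" for \<xi>
    using that by (rule the_inv_into_f_f[OF inj])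
  have "linear_iso_on (direct_sum_scale s) ?W fun_scale (dual s) ?G"
    using dual_closed[OF vs] bij_betw_the_inv_into[OF inj_on_imp_bij_betw[OF inj]]
    by (auto simp: linear_iso_on_def G simp flip: F_add F_scale)
  then have iso: "algebras_isomorphic (direct_sum_scale s) ?W (direct_sum_mult m)
      fun_scale (dual s) ?M"
    using dual_mult_closed[OF assms(2)]
    by (auto simp: algebras_isomorphic_def G simp flip: F_mult intro!: exI[of _ ?G])
  have "\<exists>!d. case d of (a_plus, a_minus) \<Rightarrow>
            a = a_plus + a_minus \<and> a_plus \<in> ?P ` dual s \<and> a_minus \<in> ?Q ` dual s
            \<and> (a_plus, - a_minus) \<in> ?W" for a
  proof -
    obtain \<xi> where \<xi>: "\<xi> \<in> dual s" "a = ?P \<xi> - ?Q \<xi>"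
      using bij by (auto simp: bij_betw_def image_iff dest: equalityD2)
    have "?Q (fun_scale (- 1) \<xi>) = - ?Q \<xi>"
      using sharp_linear(2)[OF vs sq(2) \<xi>(1), of "- 1"] by simp
    \<comment> \<open>The negative component of the decomposition is - Q xi, which lies in the image
      of Q because it equals Q(- xi).\<close>
    then have neg: "- ?Q \<xi> \<in> ?Q ` dual s"
      using dual_closed(4)[OF vs \<xi>(1), of "- 1"] by (metis image_eqI)
    show ?thesis
    proof (rule ex1I[of _ "(?P \<xi>, - ?Q \<xi>)"], goal_cases)
      case 1
      show ?case using \<xi> neg by (auto simp: sharp_pair_def)
    next
      case (2 d)
      \<comment> \<open>The coupling condition yields one eta for both components. Hence (P - Q) eta
        = a = (P - Q) xi, and injectivity of P - Q forces eta = xi.\<close>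
      then obtain \<eta> where "\<eta> \<in> dual s" "a = fst d + snd d" "fst d = ?P \<eta>" "- snd d = ?Q \<eta>"
        by (auto simp: sharp_pair_def split: prod.splits)
      moreover from this have "?P \<eta> - ?Q \<eta> = ?P \<xi> - ?Q \<xi>"
        using \<xi>(2) by (metis add.inverse_inverse diff_conv_add_uminus)
      ultimately have "\<eta> = \<xi>"
        using bij \<xi>(1) by (auto simp: bij_betw_def dest: inj_onD)
      then show ?case
        using \<open>fst d = ?P \<eta>\<close> \<open>- snd d = ?Q \<eta>\<close> by (metis add.inverse_inverse prod.collapse)
    qed
  qed
  with sub dual iso show ?thesis by blast
qed

end
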